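(* Let $\sigma\in\frac12\mathbb{Z}_{>0}$ be the spin for a system of $N\geq 1$ particles, set $m=2\sigma+1$ and $\mathbf{m}=(m,m,\dots)$. Then the degeneracy of states with eigenvalue $W_0$ (the number of distinct states with spin $0$), i.e. the number of lattice paths starting at $(0,0)$ and ending at $(N,0)$ whose steps all belong to $\{(1,\sigma),(1,\sigma-1),\dots,(1,-\sigma)\}$ and such that every step from $(x,j_1)$ to $(x+1,j_2)$ satisfies $$|j_1-\sigma|\le j_2\le j_1+\sigma ,$$ is equal to $g_{\mathbf{m},1}(\sigma N+1)$.
   Context: Let $\mathbf{m}=(m_1,m_2,\dots)$ be an infinite sequence of integers $\geq 2$, and $n,k\ge1$. A monomial $s=x_1^{s_1}\cdots x_n^{s_n}$ is $\mathbf{m}$-free if $s_i<m_i$ for all $i$; put $s_{\le j}=x_1^{s_1}\cdots x_j^{s_j}$. For $1\le j\le n$, $$\overline{\mathrm{Crit}}_{n,\mathbf{m},k,j}=\Bigl\{s\ \Big|\ s\text{ is an }\mathbf{m}\text{-free monomial in }x_1,\dots,x_n,\ x_j\mid s,\ s_j=2\deg(s_{\le j})-k-\sum_{i=1}^{j-1}m_i+(j-1)\Bigr\},$$ $\mathrm{Crit}_{n,\mathbf{m},k,j}$ is the set of monomials $s\in\overline{\mathrm{Crit}}_{n,\mathbf{m},k,j}$ involving only $x_1,\dots,x_j$ that are not divisible by any element of $\overline{\mathrm{Crit}}_{n,\mathbf{m},k,\ell}$ with $1\le\ell<j$, and $\mathrm{Crit}_{n,\mathbf{m},k}=\bigcup_{j=1}^n\mathrm{Crit}_{n,\mathbf{m},k,j}$.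 For integers $d\ge k$, $g_{\mathbf{m},k}(d)$ is the number of $s\in\mathrm{Crit}_{n,\mathbf{m},k}$ with $\deg(s)=d$ for $n$ sufficiently large (this number is independent of $n$ for $n\gg0$). By convention $g_{\mathbf{m},k}(z/2)=0$ for odd integers $z$. *)

theory Defs
  imports Complex_Main "HOL-Library.Multiset" "HOL-Library.Product_Plus"
begin

text \<open>
  The monomial \<open>x\<^sub>1^s\<^sub>1 \<cdots> x\<^sub>n^s\<^sub>n\<close> is the multiset of its variable indices, so that
  \<open>s\<^sub>i = count s i\<close>, \<open>deg s = size s\<close>, divisibility is \<open>\<subseteq>#\<close> and
  \<open>s\<^sub>\<le>\<^sub>j = filter_mset (\<lambda>i. i \<le> j) s\<close>. Variables, and the sequence \<open>m\<close>, are indexed from 1;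
  the value \<open>m 0\<close> is never used.
\<close>

definition free_monomials :: "nat \<Rightarrow> (nat \<Rightarrow> nat) \<Rightarrow> nat multiset set" where
  "free_monomials n m = {s. set_mset s \<subseteq> {1..n} \<and> (\<forall>i\<in>{1..n}. count s i < m i)}"

definition Crit_bar :: "nat \<Rightarrow> (nat \<Rightarrow> nat) \<Rightarrow> nat \<Rightarrow> nat \<Rightarrow> nat multiset set" where
  "Crit_bar n m k j = {s \<in> free_monomials n m. j \<in># s \<and>
     int (count s j) = 2 * int (size (filter_mset (\<lambda>i. i \<le> j) s)) - int k
        - (\<Sum>i=1..<j. int (m i)) + (int j - 1)}"

definition Crit_at :: "nat \<Rightarrow> (nat \<Rightarrow> nat) \<Rightarrow> nat \<Rightarrow> nat \<Rightarrow> nat multiset set" where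
  "Crit_at n m k j = {s \<in> Crit_bar n m k j. set_mset s \<subseteq> {1..j} \<and>
     (\<forall>l\<in>{1..<j}. \<forall>t\<in>Crit_bar n m k l. \<not> t \<subseteq># s)}"

definition Crit :: "nat \<Rightarrow> (nat \<Rightarrow> nat) \<Rightarrow> nat \<Rightarrow> nat multiset set" where
  "Crit n m k = (\<Union>j\<in>{1..n}. Crit_at n m k j)"

text \<open>
  The value for \<open>n\<close> sufficiently large is the (necessarily unique) eventual value of the count.
  The argument is rational because of the convention that \<open>g\<close> vanishes at proper half-integers.
\<close>

definition g :: "(nat \<Rightarrow> nat) \<Rightarrow> nat \<Rightarrow> rat \<Rightarrow> nat" where
  "g m k d = (if d \<in> \<int>
     then (THE c. \<forall>\<^sub>F n in sequentially. card {s \<in> Crit n m k. of_nat (size s) = d} = c)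
     else 0)"

definition spin_steps :: "rat \<Rightarrow> (int \<times> rat) set" where
  "spin_steps \<sigma> = {(1, \<sigma> - of_nat i) | i :: nat. of_nat i \<le> 2 * \<sigma>}"

text \<open>A lattice path is the list of the points it visits.\<close>

definition spin_zero_paths :: "rat \<Rightarrow> nat \<Rightarrow> (int \<times> rat) list set" where
  "spin_zero_paths \<sigma> N = {ps. ps \<noteq> [] \<and> hd ps = (0, 0) \<and> last ps = (int N, 0) \<and>
     successively (\<lambda>p q. q - p \<in> spin_steps \<sigma> \<and>
       \<bar>snd p - \<sigma>\<bar> \<le> snd q \<and> snd q \<le> snd p + \<sigma>) ps}"

end

theory Submission
  imports Defs
begin

text \<open>
  Put \<open>a\<^sub>l = k - 1 + (\<Sum>i\<le>l. m\<^sub>i - 1) - 2 deg s\<^sub>\<le>\<^sub>l\<close>. The equation in the definition of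
  \<open>Crit_bar\<close> reads \<open>s\<^sub>j = 1 + a\<^sub>j\<^sub>-\<^sub>1\<close>, and by a greedy argument \<open>s\<close> avoids all divisors in
  \<open>Crit_bar\<close> of index \<open>l < j\<close> iff \<open>s\<^sub>l \<le> a\<^sub>l\<^sub>-\<^sub>1\<close> for these \<open>l\<close>. For \<open>k = 1\<close> and
  \<open>m\<^sub>i = 2\<sigma> + 1\<close>, the numbers \<open>a\<^sub>l / 2\<close> are then the heights of a lattice path: the bounds
  \<open>s\<^sub>l \<le> a\<^sub>l\<^sub>-\<^sub>1\<close> and \<open>s\<^sub>l \<le> 2\<sigma>\<close> are the two halves of \<open>\<bar>j\<^sub>1 - \<sigma>\<bar> \<le> j\<^sub>2\<close>. In degree
  \<open>\<sigma>N + 1\<close> the constraint on the last exponent forces \<open>j = N + 1\<close> and \<open>a\<^sub>N = 0\<close>.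
\<close>

section \<open>The slack of a monomial\<close>

definition slack :: "(nat \<Rightarrow> nat) \<Rightarrow> nat \<Rightarrow> nat multiset \<Rightarrow> nat \<Rightarrow> int" where
  "slack m k s l = int k - 1 + (\<Sum>i=1..l. int (m i) - 1)
     - 2 * int (size (filter_mset (\<lambda>i. i \<le> l) s))"

lemma size_filter_le_Suc:
  "size (filter_mset (\<lambda>i. i \<le> Suc l) s) = size (filter_mset (\<lambda>i. i \<le> l) s) + count s (Suc l)"
  by (induction s) auto

lemma slack_0: "0 \<notin># s \<Longrightarrow> slack m k s 0 = int k - 1"
  by (induction s) (auto simp: slack_def)

lemma slack_Suc:
  "slack m k s (Suc l) = slack m k s l + int (m (Suc l)) - 1 - 2 * int (count s (Suc l))"
  by (simp add: slack_def size_filter_le_Suc)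

lemma slack_antimono: "t \<subseteq># s \<Longrightarrow> slack m k s l \<le> slack m k t l"
  using size_mset_mono[OF multiset_filter_mono, of t s "\<lambda>i. i \<le> l"] by (simp add: slack_def)

text \<open>The exponent of \<open>Suc l\<close> occurs on both sides of the defining equation, once
  on the left and doubled inside the degree on the right; solving for it leaves a value that depends
  only on the exponents before it.\<close>

lemma Crit_bar_Suc_iff:
  "s \<in> Crit_bar n m k (Suc l) \<longleftrightarrow>
     s \<in> free_monomials n m \<and> Suc l \<in># s \<and> int (count s (Suc l)) = 1 + slack m k s l"
  by (auto simp: Crit_bar_def slack_def size_filter_le_Suc sum_subtractf
      atLeastLessThanSuc_atLeastAtMost)

text \<open>For an exponent \<open>c\<close>, the next slack is
  \<open>(slack - c) + (m - 1 - c)\<close>, and the two bounds on \<open>c\<close> make both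
  summands nonnegative.\<close>

lemma slack_nonneg:
  assumes "0 \<notin># s" "k \<ge> 1"
    and "\<And>i. i < l \<Longrightarrow> count s (Suc i) < m (Suc i) \<and> int (count s (Suc i)) \<le> slack m k s i"
  shows "slack m k s l \<ge> 0"
  using assms(3)
proof (induction l)
  case 0
  then show ?case using assms by (simp add: slack_0)
next
  case (Suc l)
  have "slack m k s l \<ge> 0" using Suc by simp
  then show ?case using Suc.prems[of l] by (simp add: slack_Suc)
qed

section \<open>Divisibility conditions as bounds on exponents\<close>

text \<open>If the first bound to fail is the one at \<open>Suc l\<close>, cutting \<open>s\<close>
  off there yields a divisor in \<open>Crit_bar\<close>. Conversely, a divisor has smaller exponents
  but larger slack, so its equation would push an exponent of \<open>s\<close> above its
  bound.\<close>

lemma no_Crit_bar_divisor_iff: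
  assumes s: "s \<in> free_monomials n m" and k: "k \<ge> 1" and j: "j \<le> n"
  shows "(\<forall>l\<in>{1..<j}. \<forall>t\<in>Crit_bar n m k l. \<not> t \<subseteq># s) \<longleftrightarrow>
           (\<forall>l. Suc l < j \<longrightarrow> int (count s (Suc l)) \<le> slack m k s l)"
    (is "?L \<longleftrightarrow> ?R")
proof
  have s0: "0 \<notin># s" using s by (auto simp: free_monomials_def)
  assume L: ?L
  have "int (count s (Suc l)) \<le> slack m k s l" if "Suc l < j" for l
    using that
  proof (induction l rule: less_induct)
    case (less l)
    \<comment> \<open>The bounds below \<open>l\<close> hold by induction, so \<open>nat\<close>
      loses nothing in the exponent chosen for \<open>t\<close>.\<close>
    have nonneg: "slack m k s l \<ge> 0"
      using less s j by (intro slack_nonneg s0 k) (auto simp: free_monomials_def)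
    show ?case
    proof (rule ccontr)
      assume "\<not> ?thesis"
      then have gt: "count s (Suc l) \<ge> Suc (nat (slack m k s l))" using nonneg by linarith
      \<comment> \<open>the greedy choice: \<open>s\<close> itself below \<open>Suc l\<close>, and the least exponent that works there\<close>
      define t where "t = filter_mset (\<lambda>i. i \<le> l) s +
        replicate_mset (Suc (nat (slack m k s l))) (Suc l)"
      have cnt: "count t i = (if i \<le> l then count s i else
          if i = Suc l then Suc (nat (slack m k s l)) else 0)" for i
        by (auto simp: t_def)
      have "t \<subseteq># s" using gt by (auto simp: subseteq_mset_def cnt)
      moreover from this have "t \<in> free_monomials n m"
        using s by (fastforce simp: free_monomials_def dest: mset_subset_eqD
            intro: le_less_trans[OF mset_subset_eq_count])
      moreover have "filter_mset (\<lambda>i. i \<le> l) t = filter_mset (\<lambda>i. i \<le> l) s"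
        by (rule multiset_eqI) (auto simp: cnt)
      then have "slack m k t l = slack m k s l" by (simp add: slack_def)
      moreover have "Suc l \<in># t" by (simp add: t_def)
      ultimately have "t \<in> Crit_bar n m k (Suc l)"
        using nonneg by (simp add: Crit_bar_Suc_iff cnt)
      then show False using L less.prems \<open>t \<subseteq># s\<close> by force
    qed
  qed
  then show ?R by blast
next
  assume R: ?R
  show ?L
  proof (intro ballI notI)
    fix l t assume l: "l \<in> {1..<j}" and t: "t \<in> Crit_bar n m k l" and "t \<subseteq># s"
    then obtain l' where l': "l = Suc l'" by (cases l) auto
    have "int (count t l) = 1 + slack m k t l'" using t l' by (simp add: Crit_bar_Suc_iff)
    moreover have "count t l \<le> count s l" using \<open>t \<subseteq># s\<close> by (rule mset_subset_eq_count)
    moreover have "int (count s l) \<le> slack m k s l'" using R l l' by auto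
    ultimately show False using slack_antimono[OF \<open>t \<subseteq># s\<close>, of m k l'] by linarith
  qed
qed

text \<open>Beyond \<open>Suc j\<close> all exponents vanish and freeness amounts to
  \<open>m i \<ge> 1\<close>. Hence \<open>n\<close> drops out of the description, which is the
  source of the stabilisation for large \<open>n\<close>.\<close>

lemma Crit_at_Suc_iff:
  assumes "k \<ge> 1" "Suc j \<le> n" and m: "\<And>i. m i \<ge> 1"
  shows "s \<in> Crit_at n m k (Suc j) \<longleftrightarrow> set_mset s \<subseteq> {1..Suc j} \<and>
    (\<forall>l<j. count s (Suc l) < m (Suc l) \<and> int (count s (Suc l)) \<le> slack m k s l) \<and>
    int (count s (Suc j)) = 1 + slack m k s j \<and> count s (Suc j) < m (Suc j)"
    (is "_ \<longleftrightarrow> ?R")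
proof
  assume "s \<in> Crit_at n m k (Suc j)"
  then have c: "s \<in> Crit_bar n m k (Suc j)" "set_mset s \<subseteq> {1..Suc j}"
    and d: "\<forall>l\<in>{1..<Suc j}. \<forall>t\<in>Crit_bar n m k l. \<not> t \<subseteq># s"
    by (auto simp: Crit_at_def)
  have f: "s \<in> free_monomials n m" using c by (simp add: Crit_bar_Suc_iff)
  show ?R
    using c f d[unfolded no_Crit_bar_divisor_iff[OF f assms(1,2)]] assms(2)
    by (auto simp: Crit_bar_Suc_iff free_monomials_def)
next
  assume R: ?R
  have s0: "0 \<notin># s" using R by auto
  have "count s i < m i" for i
  proof (cases "i \<in># s")
    case True
    then obtain l where "i = Suc l" "l \<le> j" using R by (cases i) auto
    then show ?thesis using R by (cases "l = j") auto
  next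
    case False
    then show ?thesis using m[of i] by (simp add: not_in_iff)
  qed
  then have f: "s \<in> free_monomials n m" using R assms(2) by (fastforce simp: free_monomials_def)
  \<comment> \<open>With nonnegative slack the last exponent is at least 1, which gives the
    divisibility by the last variable demanded in \<open>Crit_bar\<close>.\<close>
  have "slack m k s j \<ge> 0" using R by (intro slack_nonneg s0 assms) auto
  then have "Suc j \<in># s" using R by (simp flip: count_greater_zero_iff)
  then show "s \<in> Crit_at n m k (Suc j)"
    using R f no_Crit_bar_divisor_iff[OF f assms(1,2)]
    by (auto simp: Crit_at_def Crit_bar_Suc_iff)
qed

section \<open>Critical monomials in degree \<open>\<sigma> * N + 1\<close>\<close>

text \<open>The exponents of the first \<open>N\<close> variables encode the steps of a path; the last factor is
  the variable \<open>x\<^sub>N\<^sub>+\<^sub>1\<close>.\<close>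

definition path_monomials :: "nat \<Rightarrow> nat \<Rightarrow> nat multiset set" where
  "path_monomials m N = {s. set_mset s \<subseteq> {1..Suc N} \<and>
     (\<forall>l<N. count s (Suc l) < m \<and> int (count s (Suc l)) \<le> slack (\<lambda>_. m) 1 s l) \<and>
     slack (\<lambda>_. m) 1 s N = 0 \<and> count s (Suc N) = 1}"

lemma slack_const_size:
  assumes "set_mset s \<subseteq> {1..Suc j}"
  shows "slack (\<lambda>_. m) 1 s j = int j * (int m - 1) - 2 * (int (size s) - int (count s (Suc j)))"
proof -
  have "filter_mset (\<lambda>i. i \<le> Suc j) s = s" using assms by (intro multiset_eqI) (auto simp: not_in_iff)
  then show ?thesis using size_filter_le_Suc[of j s] by (simp add: slack_def)
qed

text \<open>Fixing the degree makes the slack before the last variable equal to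
  \<open>(N - j) * (m - 1)\<close>. It lies between \<open>0\<close> and \<open>m - 2\<close>, the
  latter because the last exponent \<open>1 + slack\<close> is below \<open>m\<close>; hence
  \<open>j = N\<close>.\<close>

lemma Crit_degree_eq_path_monomials:
  assumes m: "m \<ge> 2" and n: "Suc N \<le> n"
  shows "{s \<in> Crit n (\<lambda>_. m) 1. 2 * int (size s) = int N * (int m - 1) + 2} = path_monomials m N"
proof (intro set_eqI iffI)
  fix s assume "s \<in> {s \<in> Crit n (\<lambda>_. m) 1. 2 * int (size s) = int N * (int m - 1) + 2}"
  then obtain j' where j': "j' \<in> {1..n}" "s \<in> Crit_at n (\<lambda>_. m) 1 j'"
    and deg: "2 * int (size s) = int N * (int m - 1) + 2"
    by (auto simp: Crit_def)
  then obtain j where "j' = Suc j" by (cases j') auto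
  with j' m have j: "set_mset s \<subseteq> {1..Suc j}"
    "\<forall>l<j. count s (Suc l) < m \<and> int (count s (Suc l)) \<le> slack (\<lambda>_. m) 1 s l"
    "int (count s (Suc j)) = 1 + slack (\<lambda>_. m) 1 s j" "count s (Suc j) < m"
    by (auto simp: Crit_at_Suc_iff)
  have nonneg: "slack (\<lambda>_. m) 1 s j \<ge> 0" using j by (intro slack_nonneg) auto
  have eq: "slack (\<lambda>_. m) 1 s j = (int N - int j) * (int m - 1)"
    using slack_const_size[OF j(1), of m] deg j(3) by (simp add: algebra_simps)
  have "j = N"
  proof (rule ccontr)
    assume "j \<noteq> N"
    then consider "int N - int j \<le> -1" | "int N - int j \<ge> 1" by linarith
    then show False
    proof cases
      case 1
      then have "(int N - int j) * (int m - 1) < 0" using m by (intro mult_neg_pos) auto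
      then show False using eq nonneg by linarith
    next
      case 2
      then have "1 * (int m - 1) \<le> (int N - int j) * (int m - 1)"
        using m by (intro mult_right_mono) auto
      then have "int m - 1 \<le> slack (\<lambda>_. m) 1 s j" by (simp only: eq mult_1)
      then show False using j(3,4) by linarith
    qed
  qed
  with j eq show "s \<in> path_monomials m N" by (simp add: path_monomials_def)
next
  fix s assume s: "s \<in> path_monomials m N"
  then have "s \<in> Crit_at n (\<lambda>_. m) 1 (Suc N)"
    using m n by (auto simp: path_monomials_def Crit_at_Suc_iff)
  then have "s \<in> Crit n (\<lambda>_. m) 1" using n by (force simp: Crit_def)
  moreover have "2 * int (size s) = int N * (int m - 1) + 2"
    using s slack_const_size[of s N m] by (auto simp: path_monomials_def)
  ultimately show "s \<in> {s \<in> Crit n (\<lambda>_. m) 1. 2 * int (size s) = int N * (int m - 1) + 2}"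
    by simp
qed

section \<open>The eventual value of the counts\<close>

text \<open>Two eventual values agree at some common \<open>n\<close>, since
  \<open>sequentially\<close> is a proper filter; so \<open>THE\<close> picks the expected
  number.\<close>

lemma g_eqI:
  assumes "d \<in> \<int>"
    and "\<And>n. n \<ge> n0 \<Longrightarrow> card {s \<in> Crit n m k. of_nat (size s) = d} = c"
  shows "g m k d = c"
proof -
  have ev: "\<forall>\<^sub>F n in sequentially. card {s \<in> Crit n m k. of_nat (size s) = d} = c"
    using assms(2) by (auto simp: eventually_sequentially)
  have "(THE c. \<forall>\<^sub>F n in sequentially. card {s \<in> Crit n m k. of_nat (size s) = d} = c) = c"
  proof (rule the_equality)
    show "\<forall>\<^sub>F n in sequentially. card {s \<in> Crit n m k. of_nat (size s) = d} = c" by (fact ev)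
  next
    fix c' assume "\<forall>\<^sub>F n in sequentially. card {s \<in> Crit n m k. of_nat (size s) = d} = c'"
    from eventually_happens'[OF sequentially_bot eventually_conj[OF ev this]]
    show "c' = c" by blast
  qed
  then show ?thesis unfolding g_def if_P[OF assms(1)] .
qed

lemma g_eq_card_path_monomials:
  fixes \<sigma> :: rat
  assumes "m \<ge> 2" and m\<sigma>: "of_nat m = 2 * \<sigma> + 1"
  shows "g (\<lambda>_. m) 1 (\<sigma> * of_nat N + 1) = card (path_monomials m N)"
proof (cases "\<sigma> * of_nat N + 1 \<in> \<int>")
  case True
  have \<sigma>: "\<sigma> = (of_nat m - 1) / 2" using m\<sigma> by simp
  have deg: "of_nat (size s) = \<sigma> * of_nat N + 1 \<longleftrightarrow>
      2 * int (size s) = int N * (int m - 1) + 2" for s :: "nat multiset"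
  proof -
    have "2 * int (size s) = int N * (int m - 1) + 2 \<longleftrightarrow>
        (of_int (2 * int (size s)) :: rat) = of_int (int N * (int m - 1) + 2)"
      by (simp only: of_int_eq_iff)
    also have "\<dots> \<longleftrightarrow> of_nat (size s) = \<sigma> * of_nat N + 1" by (simp add: \<sigma> field_simps)
    finally show ?thesis ..
  qed
  \<comment> \<open>From \<open>n = N + 1\<close> on, every variable that a path monomial can
    contain is available.\<close>
  show ?thesis
    by (rule g_eqI[OF True, of "Suc N"])
      (simp only: deg Crit_degree_eq_path_monomials[OF assms(1)])
next
  case False
  \<comment> \<open>This matches the convention for half-integers: slack 0 at \<open>N\<close>
    forces \<open>N * (m - 1)\<close> to be even.\<close>
  have "path_monomials m N = {}"
  proof (rule equals0I)
    fix s assume "s \<in> path_monomials m N"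
    then have "int N * (int m - 1) = 2 * (int (size s) - 1)"
      using slack_const_size[of s N m] by (auto simp: path_monomials_def)
    then have "(of_int (int N * (int m - 1)) :: rat) = of_int (2 * (int (size s) - 1))" by simp
    then have "\<sigma> * of_nat N + 1 = of_nat (size s)" using m\<sigma> by (simp add: algebra_simps)
    then show False using False by simp
  qed
  then show ?thesis using False by (simp add: g_def)
qed

section \<open>The bijection with lattice paths\<close>

text \<open>An exponent \<open>c\<close> changes the slack by \<open>m - 1 - 2 * c\<close>, twice
  the step height \<open>\<sigma> - c\<close>; hence the division by 2.\<close>

definition monomial_path :: "nat \<Rightarrow> nat \<Rightarrow> nat multiset \<Rightarrow> (int \<times> rat) list" where
  "monomial_path m N s = map (\<lambda>i. (int i, of_int (slack (\<lambda>_. m) 1 s i) / 2)) [0..<Suc N]"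

text \<open>Differences of consecutive slacks recover the exponents up to \<open>N\<close>, and the
  one at \<open>Suc N\<close> is always 1.\<close>

lemma inj_on_monomial_path: "inj_on (monomial_path m N) (path_monomials m N)"
proof (rule inj_onI)
  fix s t assume s: "s \<in> path_monomials m N" and t: "t \<in> path_monomials m N"
    and eq: "monomial_path m N s = monomial_path m N t"
  have sl: "slack (\<lambda>_. m) 1 s i = slack (\<lambda>_. m) 1 t i" if "i \<le> N" for i
    using arg_cong[OF eq, of "\<lambda>ps. snd (ps ! i)"] that
    by (simp add: monomial_path_def nth_map_upt del: upt_Suc)
  have "count s i = count t i" for i
  proof (cases "i \<in> {1..N}")
    case True
    then obtain l where "i = Suc l" "Suc l \<le> N" by (cases i) auto
    then show ?thesis
      using sl[of l] sl[of "Suc l"] by (simp add: slack_Suc)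
  next
    case False
    show ?thesis
    proof (cases "i = Suc N")
      case True
      then show ?thesis using s t by (simp add: path_monomials_def)
    next
      case ne: False
      have "i \<notin># s" "i \<notin># t" using s t False ne by (auto simp: path_monomials_def)
      then show ?thesis by (simp add: not_in_iff)
    qed
  qed
  then show "s = t" by (rule multiset_eqI)
qed

lemma monomial_path_in_spin_zero_paths:
  fixes \<sigma> :: rat
  assumes m\<sigma>: "of_nat m = 2 * \<sigma> + 1" and s: "s \<in> path_monomials m N"
  shows "monomial_path m N s \<in> spin_zero_paths \<sigma> N"
proof -
  have "set_mset s \<subseteq> {1..Suc N}" using s by (simp add: path_monomials_def)
  then have s0: "0 \<notin># s" by auto
  have step: "(int (Suc i), of_int (slack (\<lambda>_. m) 1 s (Suc i)) / 2) -
        (int i, of_int (slack (\<lambda>_. m) 1 s i) / 2) \<in> spin_steps \<sigma> \<and>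
      \<bar>of_int (slack (\<lambda>_. m) 1 s i) / 2 - \<sigma>\<bar> \<le> of_int (slack (\<lambda>_. m) 1 s (Suc i)) / 2 \<and>
      of_int (slack (\<lambda>_. m) 1 s (Suc i)) / 2 \<le> of_int (slack (\<lambda>_. m) 1 s i) / 2 + \<sigma>"
    if "i < N" for i
  proof -
    define c where "c = count s (Suc i)"
    have "c < m" "int c \<le> slack (\<lambda>_. m) 1 s i"
      using s that by (auto simp: path_monomials_def c_def)
    then have "of_nat (Suc c) \<le> (of_nat m :: rat)"
      "of_int (int c) \<le> (of_int (slack (\<lambda>_. m) 1 s i) :: rat)"
      by (simp_all only: of_nat_le_iff of_int_le_iff Suc_le_eq)
    then have c: "of_nat c \<le> 2 * \<sigma>" "of_nat c \<le> (of_int (slack (\<lambda>_. m) 1 s i) :: rat)"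
      using m\<sigma> by simp_all
    have h: "of_int (slack (\<lambda>_. m) 1 s (Suc i)) / 2 =
        of_int (slack (\<lambda>_. m) 1 s i) / 2 + \<sigma> - of_nat c"
      using m\<sigma> by (simp add: slack_Suc c_def)
    \<comment> \<open>With heights \<open>j1\<close> and \<open>j2 = j1 + \<sigma> - c\<close>, the
      bound \<open>c \<le> 2 * \<sigma>\<close> makes the step admissible and gives
      \<open>j1 - \<sigma> \<le> j2\<close>; the bound by the slack \<open>2 * j1\<close> gives
      \<open>\<sigma> - j1 \<le> j2\<close>.\<close>
    show ?thesis
      unfolding h using c by (auto simp: spin_steps_def abs_le_iff intro!: exI[of _ c])
  qed
  show ?thesis
    unfolding spin_zero_paths_def mem_Collect_eq
  proof (intro conjI)
    show "monomial_path m N s \<noteq> []" by (simp add: monomial_path_def)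
    show "hd (monomial_path m N s) = (0, 0)"
      by (simp add: monomial_path_def slack_0[OF s0] hd_map del: upt_Suc)
    show "last (monomial_path m N s) = (int N, 0)"
      using s by (simp add: monomial_path_def path_monomials_def)
    show "successively (\<lambda>p q. q - p \<in> spin_steps \<sigma> \<and>
       \<bar>snd p - \<sigma>\<bar> \<le> snd q \<and> snd q \<le> snd p + \<sigma>) (monomial_path m N s)"
      using step by (auto simp: monomial_path_def successively_conv_nth simp del: upt_Suc)
  qed
qed

lemma spin_zero_paths_subset_monomial_paths:
  fixes \<sigma> :: rat
  assumes m\<sigma>: "of_nat m = 2 * \<sigma> + 1" and ps: "ps \<in> spin_zero_paths \<sigma> N"
  shows "ps \<in> monomial_path m N ` path_monomials m N"
proof -
  have ne: "ps \<noteq> []" and start: "ps ! 0 = (0, 0)" and fin: "ps ! (length ps - 1) = (int N, 0)"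
    using ps by (auto simp: spin_zero_paths_def hd_conv_nth last_conv_nth)
  have step: "ps ! Suc i - ps ! i \<in> spin_steps \<sigma>"
    "\<bar>snd (ps ! i) - \<sigma>\<bar> \<le> snd (ps ! Suc i)" if "Suc i < length ps" for i
    using ps that by (auto simp: spin_zero_paths_def successively_conv_nth)
  \<comment> \<open>Each step advances the abscissa by 1, so list index and abscissa coincide, and
    the endpoint then fixes the length of the list.\<close>
  have fst_nth: "fst (ps ! i) = int i" if "i < length ps" for i
    using that
  proof (induction i)
    case 0
    then show ?case by (simp add: start)
  next
    case (Suc i)
    have "fst (ps ! Suc i - ps ! i) = 1"
      using step(1)[OF Suc.prems] by (auto simp: spin_steps_def simp del: fst_diff)
    then show ?case using Suc by simp
  qed
  have len: "length ps = Suc N"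
    using fst_nth[of "length ps - 1"] fin ne by (cases ps) auto
  have "\<exists>c. snd (ps ! Suc i) = snd (ps ! i) + \<sigma> - of_nat c \<and> of_nat c \<le> 2 * \<sigma>"
    if i: "i < N" for i
  proof -
    obtain c where "ps ! Suc i - ps ! i = (1, \<sigma> - of_nat c)" "of_nat c \<le> 2 * \<sigma>"
      using step(1)[of i] i len by (auto simp: spin_steps_def)
    then have "snd (ps ! Suc i) - snd (ps ! i) = \<sigma> - of_nat c" by (metis snd_conv snd_diff)
    with \<open>of_nat c \<le> 2 * \<sigma>\<close> show ?thesis by (intro exI[of _ c]) simp
  qed
  then obtain c where c: "\<And>i. i < N \<Longrightarrow> snd (ps ! Suc i) = snd (ps ! i) + \<sigma> - of_nat (c i)"
    "\<And>i. i < N \<Longrightarrow> of_nat (c i) \<le> 2 * \<sigma>"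
    by metis
  \<comment> \<open>The drops \<open>c i\<close> below the maximal step become the exponents. The
    path ends at height 0, so the last exponent \<open>1 + slack\<close> has to be 1.\<close>
  define s where "s = (\<Sum>i<N. replicate_mset (c i) (Suc i)) + {#Suc N#}"
  have cnt: "count s (Suc i) = (if i < N then c i else if i = N then 1 else 0)" for i
    by (auto simp: s_def count_sum)
  have set: "set_mset s \<subseteq> {1..Suc N}"
    by (auto simp: s_def set_mset_sum split: if_splits)
  have slack: "of_int (slack (\<lambda>_. m) 1 s i) = 2 * snd (ps ! i)" if "i \<le> N" for i
    using that
  proof (induction i)
    case 0
    have "0 \<notin># s" using set by auto
    then show ?case by (simp add: start slack_0)
  next
    case (Suc i)
    then show ?case using c(1)[of i] m\<sigma> by (simp add: slack_Suc cnt)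
  qed
  have "c l < m \<and> int (c l) \<le> slack (\<lambda>_. m) 1 s l" if l: "l < N" for l
  proof -
    have "(of_nat (c l) :: rat) < of_nat m" using c(2)[OF l] m\<sigma> by simp
    \<comment> \<open>This half of the path condition bounds the drop \<open>c l\<close> by twice
      the current height, which is the slack.\<close>
    moreover have "\<sigma> - snd (ps ! l) \<le> snd (ps ! Suc l)"
      using step(2)[of l] l len by (simp add: abs_le_iff)
    then have "of_int (int (c l)) \<le> (of_int (slack (\<lambda>_. m) 1 s l) :: rat)"
      using c(1)[OF l] slack[of l] l by simp
    ultimately show ?thesis by (simp only: of_int_le_iff of_nat_less_iff)
  qed
  moreover have "slack (\<lambda>_. m) 1 s N = 0" using slack[of N] fin len by simp
  ultimately have "s \<in> path_monomials m N" using set by (simp add: path_monomials_def cnt)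
  moreover have "ps = monomial_path m N s"
    using len slack
    by (intro nth_equalityI)
      (auto simp: monomial_path_def prod_eq_iff fst_nth nth_append simp del: upt_Suc)
  ultimately show ?thesis by blast
qed

theorem proposition5p8:
  fixes \<sigma> :: rat and N m :: nat
  assumes "2 * \<sigma> \<in> \<int>" and "\<sigma> > 0" and "N \<ge> 1" and "of_nat m = 2 * \<sigma> + 1"
  shows "card (spin_zero_paths \<sigma> N) = g (\<lambda>_. m) 1 (\<sigma> * of_nat N + 1)"
proof -
  have "(of_nat m :: rat) > of_nat 1" using assms by simp
  then have "m \<ge> 2" by (simp only: of_nat_less_iff)
  have "spin_zero_paths \<sigma> N = monomial_path m N ` path_monomials m N"
    using monomial_path_in_spin_zero_paths[OF assms(4)]
      spin_zero_paths_subset_monomial_paths[OF assms(4)] by blast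
  then show ?thesis
    using g_eq_card_path_monomials[OF \<open>m \<ge> 2\<close> assms(4)]
    by (simp add: card_image inj_on_monomial_path)
qed

end
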